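(* Let $0<\varepsilon<1/100$. The set $\mathcal{A}_\varepsilon\subset\mathbb{R}^2$ is not countably $1$-rectifiable.
   Context: A set $M\subset\mathbb{R}^2$ is countably $1$-rectifiable if $M\subset M_0\cup\bigcup_{j=1}^\infty F_j(\mathbb{R})$ with $\mathcal{H}^1(M_0)=0$ and $F_j:\mathbb{R}\to\mathbb{R}^2$ Lipschitz. Triangular caps: for a segment $S=[a,b]\subset\mathbb{R}^2$ and $h>0$, an $h$-triangular cap on $S$ is the closed solid isosceles triangle with base $S$ and third vertex (apex) $\frac{a+b}{2}+c$, where $|c|=h$ and $c\perp b-a$. If $S$ is an edge of a previously constructed cap $T$, the side is chosen so that the new cap is contained in $T$; on the initial segment $[(0,0),(1,0)]$ the apex has positive second coordinate. Construction of $A_\varepsilon$: Let $A_0=A_{0,1}=[(0,0),(1,0)]$. Given $A_n=\bigcup_{i=1}^{2^n}A_{n,i}$, a polygonal curve from $(0,0)$ to $(1,0)$ whose segments are numbered consecutively from $(0,0)$ to $(1,0)$, let $T_{n,i}$ be the $2^{1-n}\varepsilon$-triangular cap on $A_{n,i}$, let $A_{n+1,2i-1},A_{n+1,2i}$ be the two edges of $T_{n,i}$ other than its base $A_{n,i}$, and let $A_{n+1}=\bigcup_{k=1}^{2^{n+1}}A_{n+1,k}$. Define $A_\varepsilon:=\overline{\bigcup_{n=1}^\infty A_n}\setminus\bigcup_{n=1}^\infty A_n$. Construction of $\mathcal{A}_\varepsilon$: Let $a_{n,i}$ be the apex of $T_{n,i}$. Set $e_1=(0,0)$, $e_2=(1,0)$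 and $e_{2+i+\sum_{j=0}^{n-1}2^j}=a_{n,i}$ for $n\ge0$, $1\le i\le 2^n$. Set $\rho_1=\frac14 2^{-7}(1+7\cdot16\varepsilon^2)^{1/2}$ and $\rho_i=4^{1-i}\rho_1$. Let $r_1=\rho_1$, $r_2=\rho_2$, and for $i\ge3$, with $n\ge0$ the unique integer such that $2+\sum_{j=0}^n2^j\le i\le 1+\sum_{j=0}^{n+1}2^j$, let $r_i=\min\{\rho_i,\tfrac12 d(e_i,A_{n-1}\cup A_{n-2})\}$, where sets $A_k$ with $k<0$ are omitted (so $r_i=\rho_i$ when $n=0$). Define $\mathcal{A}_\varepsilon:=A_\varepsilon\setminus\bigcup_{i=1}^\infty B_{r_i}(e_i)$, with $B_r(e)$ open balls. *)

theory Defs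
  imports "HOL-Analysis.Analysis"
begin

section \<open>Countable 1-rectifiability\<close>

text \<open>
  One-dimensional Hausdorff (outer) measure, normalised so that a segment has its length as measure.
  Boundedness of the covering sets is required explicitly because \<^const>\<open>diameter\<close> is
  real-valued and carries no information on unbounded sets.
\<close>

definition hausdorff1_pre :: "real \<Rightarrow> 'a::metric_space set \<Rightarrow> ennreal" where
  "hausdorff1_pre \<delta> M =
     (INF C \<in> {C :: nat \<Rightarrow> 'a set. M \<subseteq> (\<Union>j. C j) \<and> (\<forall>j. bounded (C j) \<and> diameter (C j) \<le> \<delta>)}.
        (\<Sum>j. ennreal (diameter (C j))))"

definition hausdorff1 :: "'a::metric_space set \<Rightarrow> ennreal" where
  "hausdorff1 M = (SUP \<delta> \<in> {0<..}. hausdorff1_pre \<delta> M)"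

type_synonym plane = "real \<times> real"

definition countably_1_rectifiable :: "plane set \<Rightarrow> bool" where
  "countably_1_rectifiable M \<longleftrightarrow>
     (\<exists>M0 (F :: nat \<Rightarrow> real \<Rightarrow> plane).
        hausdorff1 M0 = 0 \<and>
        (\<forall>j. \<exists>L. L-lipschitz_on UNIV (F j)) \<and>
        M \<subseteq> M0 \<union> (\<Union>j. range (F j)))"


section \<open>Triangular caps and the polygonal curves\<close>

text \<open>
  The two possible apexes of an \<open>h\<close>-triangular cap on the segment from \<open>a\<close> to \<open>b\<close>; the cap with
  apex \<open>p\<close> is \<open>convex hull {a, b, p}\<close>.
\<close>

definition cap_apexes :: "real \<Rightarrow> plane \<Rightarrow> plane \<Rightarrow> plane set" where
  "cap_apexes h a b = {midpoint a b + c | c. norm c = h \<and> orthogonal c (b - a)}"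

definition cap_height :: "real \<Rightarrow> nat \<Rightarrow> real" where
  "cap_height \<epsilon> n = 2 powi (1 - int n) * \<epsilon>"

text \<open>
  \<open>cap_vertices \<epsilon> n i = (a, b, p)\<close> describes the cap \<open>T\<^sub>n\<^sub>,\<^sub>i\<close>: its base is the segment
  \<open>A\<^sub>n\<^sub>,\<^sub>i\<close> from \<open>a\<close> to \<open>b\<close>, traversed in the direction from \<open>(0, 0)\<close> to \<open>(1, 0)\<close>, and its apex
  is \<open>p\<close>.  Only \<open>1 \<le> i \<le> 2 ^ n\<close> is meaningful.  The base \<open>A\<^sub>n\<^sub>+\<^sub>1\<^sub>,\<^sub>i\<close> is an edge of
  \<open>T\<^sub>n\<^sub>,\<^sub>k\<close> with \<open>k = (i + 1) div 2\<close>: the first one for \<open>i = 2 * k - 1\<close>, the second one for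
  \<open>i = 2 * k\<close>.
\<close>

primrec cap_vertices :: "real \<Rightarrow> nat \<Rightarrow> nat \<Rightarrow> plane \<times> plane \<times> plane" where
  "cap_vertices \<epsilon> 0 i =
     ((0, 0), (1, 0), THE p. p \<in> cap_apexes (cap_height \<epsilon> 0) (0, 0) (1, 0) \<and> snd p > 0)"
| "cap_vertices \<epsilon> (Suc n) i =
     (let (a, b, p) = cap_vertices \<epsilon> n ((i + 1) div 2);
          (u, v) = (if odd i then (a, p) else (p, b))
      in (u, v, THE q. q \<in> cap_apexes (cap_height \<epsilon> (Suc n)) u v \<and>
                       convex hull {u, v, q} \<subseteq> convex hull {a, b, p}))"

definition poly_segment :: "real \<Rightarrow> nat \<Rightarrow> nat \<Rightarrow> plane set" where
  "poly_segment \<epsilon> n i = (let (a, b, p) = cap_vertices \<epsilon> n i in closed_segment a b)"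

definition cap_apex :: "real \<Rightarrow> nat \<Rightarrow> nat \<Rightarrow> plane" where
  "cap_apex \<epsilon> n i = (let (a, b, p) = cap_vertices \<epsilon> n i in p)"

definition poly_curve :: "real \<Rightarrow> nat \<Rightarrow> plane set" where
  "poly_curve \<epsilon> n = (\<Union>i\<in>{1..2 ^ n}. poly_segment \<epsilon> n i)"

definition A_limit :: "real \<Rightarrow> plane set" where
  "A_limit \<epsilon> = closure (\<Union>n\<in>{1..}. poly_curve \<epsilon> n) - (\<Union>n\<in>{1..}. poly_curve \<epsilon> n)"


section \<open>Removing small balls around the vertices\<close>

text \<open>The sequences below are indexed from 1; their values at 0 are never used.\<close>

definition vertex :: "real \<Rightarrow> nat \<Rightarrow> plane" where
  "vertex \<epsilon> k =
     (if k = 1 then (0, 0)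
      else if k = 2 then (1, 0)
      else (THE p. \<exists>n i. 1 \<le> i \<and> i \<le> 2 ^ n \<and> k = 2 + i + (\<Sum>j<n. 2 ^ j) \<and> p = cap_apex \<epsilon> n i))"

definition rho :: "real \<Rightarrow> nat \<Rightarrow> real" where
  "rho \<epsilon> i = 4 powi (1 - int i) * (1/4 * 2 powi (-7) * sqrt (1 + 7 * 16 * \<epsilon>\<^sup>2))"

text \<open>
  In \<open>radius\<close>, the union is \<open>A\<^sub>n\<^sub>-\<^sub>1 \<union> A\<^sub>n\<^sub>-\<^sub>2\<close> with negative indices omitted.  For \<open>n = 0\<close> it is
  empty, and the distance term has to be dropped separately because \<^const>\<open>infdist\<close> to the empty
  set is 0 rather than infinite.
\<close>

definition radius_level :: "nat \<Rightarrow> nat" where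
  "radius_level i =
     (THE n. 2 + (\<Sum>j\<in>{0..n}. 2 ^ j) \<le> i \<and> i \<le> 1 + (\<Sum>j\<in>{0..n+1}. 2 ^ j))"

definition radius :: "real \<Rightarrow> nat \<Rightarrow> real" where
  "radius \<epsilon> i =
     (if i \<le> 2 \<or> radius_level i = 0 then rho \<epsilon> i
      else min (rho \<epsilon> i)
             (1/2 * infdist (vertex \<epsilon> i)
                (\<Union>k\<in>{k. k + 1 = radius_level i \<or> k + 2 = radius_level i}. poly_curve \<epsilon> k)))"

definition A_final :: "real \<Rightarrow> plane set" where
  "A_final \<epsilon> = A_limit \<epsilon> - (\<Union>i\<in>{1..}. ball (vertex \<epsilon> i) (radius \<epsilon> i))"

end

theory Submission
  imports Defs "HOL-Real_Asymp.Real_Asymp"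
begin

text \<open>
  The caps form a binary tree of nested flat triangles, whose limit is a curve \<open>\<gamma>\<close> on \<open>[0, 1)\<close>: the
  point \<open>\<gamma> t\<close> lies in the cap of level \<open>n\<close> over the dyadic interval of length \<open>1 / 2 ^ n\<close> around \<open>t\<close>.
  By Pythagoras the segments of level \<open>n\<close> have length \<open>sqrt (1 + 16 n \<epsilon>\<^sup>2) / 2 ^ n\<close>. Two caps of
  the same level meet at an obtuse angle if they are adjacent, and otherwise have distance at least
  half of that length. Hence a set of diameter \<open>d\<close> pulls back under \<open>\<gamma>\<close> to a set of measure \<open>o(d)\<close>,
  uniformly as \<open>d \<rightarrow> 0\<close>. So the preimages of \<open>H\<^sup>1\<close>-null sets and of Lipschitz curves, and in
  particular of the polygonal curves themselves, are Lebesgue null. The preimages of the removed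
  balls have total measure at most \<open>1/24\<close>, as their radii are at most \<open>rho\<close>. So a countably
  1-rectifiable \<open>A_final\<close> would leave a part of \<open>[0, 1)\<close> of positive measure uncovered.
\<close>

section \<open>Null sets and covers\<close>

lemma negligible_interval_cover:
  assumes "\<And>e. 0 < e \<Longrightarrow> \<exists>c r. (\<forall>j. 0 \<le> r j) \<and> S \<subseteq> (\<Union>j::nat. {c j - r j..c j + r j}) \<and>
      (\<Sum>j. ennreal (r j)) \<le> ennreal e"
  shows "negligible (S :: real set)"
  unfolding negligible_outer_le
proof (intro allI impI)
  fix e :: real assume "e > 0"
  then obtain c r where *: "\<And>j. 0 \<le> r j" "S \<subseteq> (\<Union>j::nat. {c j - r j..c j + r j})"
    "(\<Sum>j. ennreal (r j)) \<le> ennreal (e / 2)" using assms[of "e/2"] by auto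
  let ?T = "\<Union>j. {c j - r j..c j + r j}"
  have "emeasure lebesgue ?T \<le> (\<Sum>j. emeasure lebesgue {c j - r j..c j + r j})"
    by (rule emeasure_subadditive_countably) auto
  also have "\<dots> = (\<Sum>j. 2 * ennreal (r j))"
    using *(1) by (simp add: ennreal_mult'')
  also have "\<dots> \<le> 2 * ennreal (e / 2)" by (simp add: mult_left_mono *(3))
  also have "\<dots> = ennreal e" using ennreal_mult''[of "e/2" 2] \<open>e > 0\<close> by simp
  finally have T: "emeasure lebesgue ?T \<le> ennreal e" .
  then have "?T \<in> lmeasurable"
    by (intro fmeasurableI) (auto simp: order_le_less_trans)
  moreover have "measure lebesgue ?T \<le> e"
    using T \<open>e > 0\<close> by (simp add: measure_def enn2real_leI)
  ultimately show "\<exists>T. S \<subseteq> T \<and> T \<in> lmeasurable \<and> measure lebesgue T \<le> e" using * by blast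
qed

lemma hausdorff1_null_cover:
  assumes "hausdorff1 M = 0" "0 < \<delta>" "0 < \<tau>"
  obtains C where "M \<subseteq> (\<Union>j::nat. C j)" "\<And>j. bounded (C j)" "\<And>j. diameter (C j) \<le> \<delta>"
    "(\<Sum>j. ennreal (diameter (C j))) < ennreal \<tau>"
proof -
  have "hausdorff1_pre \<delta> M \<le> hausdorff1 M"
    unfolding hausdorff1_def using assms by (intro SUP_upper) auto
  then have "hausdorff1_pre \<delta> M < ennreal \<tau>" using assms by auto
  then show ?thesis unfolding hausdorff1_pre_def INF_less_iff using that by auto
qed


section \<open>Flat isosceles triangles\<close>

text \<open>Law of cosines at \<open>e\<close>: an angle of at least 90 degrees there makes the
  opposite side the longest. It is applied with \<open>e\<close> the common endpoint of two adjacent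
  caps, where it turns distances to \<open>e\<close> into distances between the caps.\<close>

lemma obtuse_dist_le:
  fixes P Q e :: "'a::real_inner"
  assumes "inner (P - e) (Q - e) \<le> 0"
  shows "dist P e \<le> dist P Q" "dist Q e \<le> dist P Q"
proof -
  have "(dist P Q)\<^sup>2 = (dist P e)\<^sup>2 + (dist Q e)\<^sup>2 - 2 * inner (P - e) (Q - e)"
    unfolding dist_norm power2_norm_eq_inner by (simp add: inner_diff inner_commute)
  then have "(dist P e)\<^sup>2 \<le> (dist P Q)\<^sup>2" "(dist Q e)\<^sup>2 \<le> (dist P Q)\<^sup>2"
    using assms zero_le_power2[of "dist P e"] zero_le_power2[of "dist Q e"] by linarith+
  then show "dist P e \<le> dist P Q" "dist Q e \<le> dist P Q"
    by (auto intro: power2_le_imp_le)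
qed

definition rot :: "plane \<Rightarrow> plane" where
  "rot v = (- snd v, fst v)"

text \<open>The triangle with base from \<open>a\<close> to \<open>a + d\<close> and signed height-to-base ratio \<open>t\<close>. Measuring heights in
  units of the apex height makes the constraints independent of \<open>t\<close>, in particular of its sign.\<close>

definition tri :: "plane \<Rightarrow> plane \<Rightarrow> real \<Rightarrow> plane set" where
  "tri a d t = {a + x *\<^sub>R d + (z * t) *\<^sub>R rot d | x z. 0 \<le> z \<and> z \<le> 2 * x \<and> z \<le> 2 * (1 - x)}"

lemma triI:
  assumes "P = a + x *\<^sub>R d + (z * t) *\<^sub>R rot d" "0 \<le> z" "z \<le> 2 * x" "z \<le> 2 * (1 - x)"
  shows "P \<in> tri a d t"
  using assms unfolding tri_def by blast

text \<open>\<open>rot\<close> is the quarter turn, so \<open>d\<close> and \<open>rot d\<close> are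
  orthogonal and equally long: coordinates in this frame are Cartesian up to the factor
  \<open>norm d\<close>.\<close>

lemma inner_rot_frame:
  "inner (x *\<^sub>R d + y *\<^sub>R rot d) (x' *\<^sub>R d + y' *\<^sub>R rot d) = (x * x' + y * y') * (norm d)\<^sup>2"
  by (cases d) (simp add: rot_def power2_norm_eq_inner algebra_simps)

lemma norm_rot_frame:
  "norm (x *\<^sub>R d + y *\<^sub>R rot d) = sqrt (x\<^sup>2 + y\<^sup>2) * norm d"
  using inner_rot_frame[of x d y x y]
  by (simp add: norm_eq_sqrt_inner[of "x *\<^sub>R d + y *\<^sub>R rot d"] real_sqrt_mult power2_eq_square)

lemma norm_rot_frame_ge: "norm (x *\<^sub>R d + y *\<^sub>R rot d) \<ge> \<bar>x\<bar> * norm d"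
proof -
  have "\<bar>x\<bar> = sqrt (x\<^sup>2)" by simp
  also have "\<dots> \<le> sqrt (x\<^sup>2 + y\<^sup>2)" by (intro real_sqrt_le_mono) simp
  finally show ?thesis by (simp add: norm_rot_frame mult_right_mono)
qed

lemma rot_frame_eq_iff:
  assumes "d \<noteq> 0"
  shows "a + x *\<^sub>R d + y *\<^sub>R rot d = a + x' *\<^sub>R d + y' *\<^sub>R rot d \<longleftrightarrow> x = x' \<and> y = y'"
proof -
  have "norm ((x - x') *\<^sub>R d + (y - y') *\<^sub>R rot d) = 0 \<longleftrightarrow> x = x' \<and> y = y'"
    unfolding norm_rot_frame using assms by (auto simp: sum_power2_eq_zero_iff)
  then show ?thesis by (simp add: algebra_simps)
qed

lemma mem_tri_iff:
  assumes "d \<noteq> 0" "t \<noteq> 0"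
  shows "a + x *\<^sub>R d + (z * t) *\<^sub>R rot d \<in> tri a d t \<longleftrightarrow> 0 \<le> z \<and> z \<le> 2 * x \<and> z \<le> 2 * (1 - x)"
  unfolding tri_def using assms by (auto simp: rot_frame_eq_iff)

text \<open>The three inequalities in \<open>tri\<close> say that the barycentric weights
  \<open>1 - x - z/2\<close>, \<open>x - z/2\<close> and \<open>z\<close> are nonnegative.\<close>

lemma convex_hull_cap: "convex hull {a, a + d, a + (1/2) *\<^sub>R d + t *\<^sub>R rot d} = tri a d t"
  (is "?L = ?R")
proof
  show "?L \<subseteq> ?R"
  proof
    fix P assume "P \<in> ?L"
    then obtain u v w where *: "0 \<le> u" "0 \<le> v" "0 \<le> w" "u + v + w = 1"
      "P = u *\<^sub>R a + v *\<^sub>R (a + d) + w *\<^sub>R (a + (1/2) *\<^sub>R d + t *\<^sub>R rot d)"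
      unfolding convex_hull_3 by blast
    have u: "u = 1 - v - w" using * by simp
    have "P = a + (v + w/2) *\<^sub>R d + (w * t) *\<^sub>R rot d"
      unfolding * u by (simp add: algebra_simps)
    then show "P \<in> ?R" by (rule triI) (use * in auto)
  qed
next
  show "?R \<subseteq> ?L"
  proof
    fix P assume "P \<in> ?R"
    then obtain x z where *: "0 \<le> z" "z \<le> 2 * x" "z \<le> 2 * (1 - x)"
      "P = a + x *\<^sub>R d + (z * t) *\<^sub>R rot d" unfolding tri_def by blast
    have "P = (1 - x - z/2) *\<^sub>R a + (x - z/2) *\<^sub>R (a + d) + z *\<^sub>R (a + (1/2) *\<^sub>R d + t *\<^sub>R rot d)"
      unfolding * by (simp add: algebra_simps) (simp flip: scaleR_add_left)
    moreover have "0 \<le> 1 - x - z/2" "0 \<le> x - z/2" "1 - x - z/2 + (x - z/2) + z = 1"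
      using * by (auto simp: field_simps)
    ultimately show "P \<in> ?L" unfolding convex_hull_3 using * by blast
  qed
qed

lemma cap_apexes_eq:
  assumes "d \<noteq> 0" "h = t * norm d" "0 \<le> t"
  shows "cap_apexes h u (u + d) = {u + (1/2) *\<^sub>R d + t *\<^sub>R rot d, u + (1/2) *\<^sub>R d - t *\<^sub>R rot d}"
    (is "?L = ?R")
proof
  obtain d1 d2 where d: "d = (d1, d2)" by (cases d)
  have n: "(norm d)\<^sup>2 = d1\<^sup>2 + d2\<^sup>2"
    by (simp only: d power2_norm_eq_inner) (simp add: power2_eq_square)
  have mid: "midpoint u (u + d) = u + (1/2) *\<^sub>R d"
    by (simp add: midpoint_def algebra_simps) (simp flip: scaleR_add_left)
  show "?R \<subseteq> ?L"
  proof -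
    have "norm (s *\<^sub>R rot d) = \<bar>s\<bar> * norm d" "orthogonal (s *\<^sub>R rot d) d" for s
      using norm_rot_frame[of 0 d s] inner_rot_frame[of 0 d s 1 0]
      by (auto simp: orthogonal_def)
    from this[of t] this[of "-t"] show ?thesis
      unfolding cap_apexes_def mid using assms
      by (simp del: split_paired_Ex)
  qed
  show "?L \<subseteq> ?R"
  proof
    fix q assume "q \<in> ?L"
    then obtain c where c: "q = u + (1/2) *\<^sub>R d + c" "norm c = h" "inner c d = 0"
      unfolding cap_apexes_def mid orthogonal_def by auto
    obtain c1 c2 where cc: "c = (c1, c2)" by (cases c)
    have o: "c1 * d1 + c2 * d2 = 0" using c by (simp add: cc d)
    \<comment> \<open>The coefficient of \<open>c\<close> along \<open>rot d\<close>: inner product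
      with \<open>rot d\<close> over squared norm. The component along \<open>d\<close> vanishes by
      orthogonality.\<close>
    define s where "s = (c2 * d1 - c1 * d2) / (norm d)\<^sup>2"
    have nz: "d1\<^sup>2 + d2\<^sup>2 \<noteq> 0" using assms n by (metis norm_eq_zero power_eq_0_iff)
    have "c1 * (d1\<^sup>2 + d2\<^sup>2) = - (c2 * d1 - c1 * d2) * d2" "c2 * (d1\<^sup>2 + d2\<^sup>2) = (c2 * d1 - c1 * d2) * d1"
      using o by algebra+
    then have cs: "c = s *\<^sub>R rot d"
      unfolding cc s_def n using nz by (simp add: rot_def d field_simps)
    then have "\<bar>s\<bar> * norm d = t * norm d"
      using norm_rot_frame[of 0 d s] norm_rot_frame[of 0 d 1] c assms by simp
    then have "s = t \<or> s = - t" using assms by auto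
    then show "q \<in> ?R" using c cs by auto
  qed
qed

text \<open>A child cap has ratio \<open>- k * t\<close>: it points to the other side of its directed base, hence into the
  parent.\<close>

locale cap_ratio =
  fixes t k :: real
  assumes t: "0 < \<bar>t\<bar>" "\<bar>t\<bar> \<le> 1/50" and k: "0 < k" "k \<le> 1"
begin

lemma t2: "0 < t\<^sup>2" "t\<^sup>2 \<le> 1/2500"
proof -
  show "0 < t\<^sup>2" using t by auto
  have "\<bar>t\<bar>\<^sup>2 \<le> (1/50)\<^sup>2" using t by (intro power_mono) auto
  then show "t\<^sup>2 \<le> 1/2500" by (simp add: power2_eq_square)
qed

lemma kt2: "0 < k * t\<^sup>2" "k * t\<^sup>2 \<le> 1/2500"
proof -
  show "0 < k * t\<^sup>2" using t2 k by simp
  have "k * t\<^sup>2 \<le> 1 * (1/2500)" using t2 k by (intro mult_mono) auto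
  then show "k * t\<^sup>2 \<le> 1/2500" by simp
qed

text \<open>Since \<open>rot (rot d) = - d\<close>, a child's own coordinates become parent
  coordinates with only a second-order shift \<open>k * t\<^sup>2 * z\<close> along the
  base.\<close>

lemma left_coords:
  "a + x *\<^sub>R ((1/2) *\<^sub>R d + t *\<^sub>R rot d) + (z * (- k * t)) *\<^sub>R rot ((1/2) *\<^sub>R d + t *\<^sub>R rot d)
   = a + (x/2 + k * t\<^sup>2 * z) *\<^sub>R d + ((x - k * z / 2) * t) *\<^sub>R rot d"
  by (cases d; cases a) (simp add: rot_def algebra_simps power2_eq_square)

lemma right_coords:
  "a + (1/2) *\<^sub>R d + t *\<^sub>R rot d + x *\<^sub>R ((1/2) *\<^sub>R d - t *\<^sub>R rot d)
     + (z * (- k * t)) *\<^sub>R rot ((1/2) *\<^sub>R d - t *\<^sub>R rot d)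
   = a + (1/2 + x/2 - k * t\<^sup>2 * z) *\<^sub>R d + ((1 - x - k * z / 2) * t) *\<^sub>R rot d"
  by (cases d; cases a) (simp add: rot_def algebra_simps power2_eq_square)

text \<open>Besides lying in the parent, the child stays in the half \<open>x \<le> 1/2\<close> and
  in the 45 degree cone that opens from the parent's apex backwards along the base; the latter is
  the bound on \<open>\<bar>t\<bar> * (1 - z)\<close>. The ratio 1/50 leaves ample room.
  \<open>right_child\<close> is the mirror image.\<close>

lemma left_child:
  assumes "P \<in> tri a ((1/2) *\<^sub>R d + t *\<^sub>R rot d) (- k * t)"
  obtains x z where "P = a + x *\<^sub>R d + (z * t) *\<^sub>R rot d" "0 \<le> z" "z \<le> 2 * x" "z \<le> 2 * (1 - x)"
    "x \<le> 1/2" "\<bar>t\<bar> * (1 - z) \<le> 1/2 - x" "z \<le> 1"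
proof -
  obtain x z where *: "0 \<le> z" "z \<le> 2 * x" "z \<le> 2 * (1 - x)"
    "P = a + (x/2 + k * t\<^sup>2 * z) *\<^sub>R d + ((x - k * z / 2) * t) *\<^sub>R rot d"
    using assms unfolding tri_def left_coords by blast
  have kz: "0 \<le> k * z" "k * z \<le> z" using k * by (auto simp: mult_left_le_one_le)
  have ktz: "0 \<le> k * t\<^sup>2 * z" "k * t\<^sup>2 * z \<le> 1/2500 * z"
    using mult_right_mono[OF kt2(2) *(1)] kt2(1) *(1) by auto
  have ktz': "k * t\<^sup>2 * z \<le> k * z / 2500"
  proof -
    have "t\<^sup>2 * (k * z) \<le> 1/2500 * (k * z)" using t2 kz by (intro mult_right_mono) auto
    then show ?thesis by (simp add: mult_ac)
  qed
  have "\<bar>t\<bar> * (1 - (x - k * z / 2)) \<le> 1/50 * (1 - (x - k * z / 2))"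
    using t * kz by (intro mult_right_mono) auto
  then show ?thesis
    using that[of "x/2 + k * t\<^sup>2 * z" "x - k * z / 2"] * kz ktz ktz' by (auto simp: field_simps)
qed

lemma right_child:
  assumes "P \<in> tri (a + (1/2) *\<^sub>R d + t *\<^sub>R rot d) ((1/2) *\<^sub>R d - t *\<^sub>R rot d) (- k * t)"
  obtains x z where "P = a + x *\<^sub>R d + (z * t) *\<^sub>R rot d" "0 \<le> z" "z \<le> 2 * x" "z \<le> 2 * (1 - x)"
    "1/2 \<le> x" "\<bar>t\<bar> * (1 - z) \<le> x - 1/2" "z \<le> 1"
proof -
  obtain x z where *: "0 \<le> z" "z \<le> 2 * x" "z \<le> 2 * (1 - x)"
    "P = a + (1/2 + x/2 - k * t\<^sup>2 * z) *\<^sub>R d + ((1 - x - k * z / 2) * t) *\<^sub>R rot d"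
    using assms unfolding tri_def right_coords by blast
  have kz: "0 \<le> k * z" "k * z \<le> z" using k * by (auto simp: mult_left_le_one_le)
  have ktz: "0 \<le> k * t\<^sup>2 * z" "k * t\<^sup>2 * z \<le> 1/2500 * z"
    using mult_right_mono[OF kt2(2) *(1)] kt2(1) *(1) by auto
  have ktz': "k * t\<^sup>2 * z \<le> k * z / 2500"
  proof -
    have "t\<^sup>2 * (k * z) \<le> 1/2500 * (k * z)" using t2 kz by (intro mult_right_mono) auto
    then show ?thesis by (simp add: mult_ac)
  qed
  have "\<bar>t\<bar> * (1 - (1 - x - k * z / 2)) \<le> 1/50 * (1 - (1 - x - k * z / 2))"
    using t * kz by (intro mult_right_mono) auto
  then show ?thesis
    using that[of "1/2 + x/2 - k * t\<^sup>2 * z" "1 - x - k * z / 2"] * kz ktz ktz'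
    by (auto simp: field_simps)
qed

lemma left_child_subset: "tri a ((1/2) *\<^sub>R d + t *\<^sub>R rot d) (- k * t) \<subseteq> tri a d t"
  by (rule subsetI, erule left_child) (rule triI)

lemma right_child_subset:
  "tri (a + (1/2) *\<^sub>R d + t *\<^sub>R rot d) ((1/2) *\<^sub>R d - t *\<^sub>R rot d) (- k * t) \<subseteq> tri a d t"
  by (rule subsetI, erule right_child) (rule triI)

text \<open>Project to the line of the base: the child has abscissa at most 1/2, the far endpoint
  has abscissa 1.\<close>

lemma left_child_far:
  assumes "P \<in> tri a ((1/2) *\<^sub>R d + t *\<^sub>R rot d) (- k * t)"
  shows "norm d / 2 \<le> dist P (a + d)"
  using assms
proof (rule left_child)
  fix x z assume *: "P = a + x *\<^sub>R d + (z * t) *\<^sub>R rot d" "x \<le> 1/2"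
  have "1/2 * norm d \<le> \<bar>x - 1\<bar> * norm d" using * by (intro mult_right_mono) auto
  also have "\<dots> \<le> norm ((x - 1) *\<^sub>R d + (z * t) *\<^sub>R rot d)" by (rule norm_rot_frame_ge)
  also have "\<dots> = dist P (a + d)" unfolding * dist_norm by (simp add: algebra_simps)
  finally show ?thesis by simp
qed

lemma right_child_far:
  assumes "P \<in> tri (a + (1/2) *\<^sub>R d + t *\<^sub>R rot d) ((1/2) *\<^sub>R d - t *\<^sub>R rot d) (- k * t)"
  shows "norm d / 2 \<le> dist P a"
  using assms
proof (rule right_child)
  fix x z assume *: "P = a + x *\<^sub>R d + (z * t) *\<^sub>R rot d" "1/2 \<le> x"
  have "1/2 * norm d \<le> \<bar>x\<bar> * norm d" using * by (intro mult_right_mono) auto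
  also have "\<dots> \<le> norm (x *\<^sub>R d + (z * t) *\<^sub>R rot d)" by (rule norm_rot_frame_ge)
  also have "\<dots> = dist P a" unfolding * dist_norm by (simp add: algebra_simps)
  finally show ?thesis by simp
qed

text \<open>The siblings lie in opposite 45 degree cones at the apex \<open>p\<close>: the
  horizontal displacements have opposite signs, and their product outweighs that of the vertical
  ones.\<close>

lemma siblings_obtuse:
  assumes "P \<in> tri a ((1/2) *\<^sub>R d + t *\<^sub>R rot d) (- k * t)"
    and "Q \<in> tri (a + (1/2) *\<^sub>R d + t *\<^sub>R rot d) ((1/2) *\<^sub>R d - t *\<^sub>R rot d) (- k * t)"
  defines "p \<equiv> a + (1/2) *\<^sub>R d + t *\<^sub>R rot d"
  shows "inner (P - p) (Q - p) \<le> 0"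
proof -
  obtain x z where P: "P = a + x *\<^sub>R d + (z * t) *\<^sub>R rot d" "\<bar>t\<bar> * (1 - z) \<le> 1/2 - x" "z \<le> 1"
    using left_child[OF assms(1)] by blast
  obtain x' z' where Q: "Q = a + x' *\<^sub>R d + (z' * t) *\<^sub>R rot d" "\<bar>t\<bar> * (1 - z') \<le> x' - 1/2" "z' \<le> 1"
    using right_child[OF assms(2)] by blast
  have P': "P - p = (x - 1/2) *\<^sub>R d + ((z - 1) * t) *\<^sub>R rot d"
    and Q': "Q - p = (x' - 1/2) *\<^sub>R d + ((z' - 1) * t) *\<^sub>R rot d"
    unfolding P Q p_def by (auto simp: algebra_simps)
  have "(\<bar>t\<bar> * (1 - z)) * (\<bar>t\<bar> * (1 - z')) \<le> (1/2 - x) * (x' - 1/2)"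
    using P Q order_trans[OF _ P(2), of 0] by (intro mult_mono mult_nonneg_nonneg) auto
  moreover have "(\<bar>t\<bar> * (1 - z)) * (\<bar>t\<bar> * (1 - z')) = ((z - 1) * t) * ((z' - 1) * t)"
    using abs_mult_self_eq[of t] by algebra
  ultimately have "(x - 1/2) * (x' - 1/2) + ((z - 1) * t) * ((z' - 1) * t) \<le> 0"
    by (simp add: algebra_simps)
  then show ?thesis unfolding P' Q' inner_rot_frame by (simp add: mult_nonpos_nonneg)
qed

text \<open>The point is the child's apex reflected in the child's base. It has height
  \<open>1/2 + k/2\<close> in apex units, above the parent's edge, whose height at that abscissa is
  \<open>1/2 - 2 * k * t\<^sup>2\<close>. This excludes the second candidate for the apex.\<close>

lemma left_apex_outside:
  assumes "d \<noteq> 0"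
  defines "d' \<equiv> (1/2) *\<^sub>R d + t *\<^sub>R rot d"
  shows "a + (1/2) *\<^sub>R d' + (k * t) *\<^sub>R rot d' \<notin> tri a d t"
proof -
  have "a + (1/2) *\<^sub>R d' + (k * t) *\<^sub>R rot d' = a + (1/4 - k * t\<^sup>2) *\<^sub>R d + ((1/2 + k/2) * t) *\<^sub>R rot d"
    unfolding d'_def by (cases d; cases a) (simp add: rot_def algebra_simps power2_eq_square)
  moreover have "\<dots> \<notin> tri a d t" 
  proof -
    have "t \<noteq> 0" using t by auto
    have "\<not> 1/2 + k/2 \<le> 2 * (1/4 - w)" if "0 < w" for w using that k by argo
    from this[OF kt2(1)] show ?thesis unfolding mem_tri_iff[OF \<open>d \<noteq> 0\<close> \<open>t \<noteq> 0\<close>] by blast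
  qed
  ultimately show ?thesis by metis
qed

lemma right_apex_outside:
  assumes "d \<noteq> 0"
  defines "d' \<equiv> (1/2) *\<^sub>R d - t *\<^sub>R rot d"
  shows "a + (1/2) *\<^sub>R d + t *\<^sub>R rot d + (1/2) *\<^sub>R d' + (k * t) *\<^sub>R rot d' \<notin> tri a d t"
proof -
  have "a + (1/2) *\<^sub>R d + t *\<^sub>R rot d + (1/2) *\<^sub>R d' + (k * t) *\<^sub>R rot d'
      = a + (3/4 + k * t\<^sup>2) *\<^sub>R d + ((1/2 + k/2) * t) *\<^sub>R rot d"
    unfolding d'_def by (cases d; cases a) (simp add: rot_def algebra_simps power2_eq_square)
  moreover have "\<dots> \<notin> tri a d t" 
  proof -
    have "t \<noteq> 0" using t by auto
    have "\<not> 1/2 + k/2 \<le> 2 * (1 - (3/4 + w))" if "0 < w" for w using that k by argo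
    from this[OF kt2(1)] show ?thesis unfolding mem_tri_iff[OF \<open>d \<noteq> 0\<close> \<open>t \<noteq> 0\<close>] by blast
  qed
  ultimately show ?thesis by metis
qed

end


section \<open>The tree of caps\<close>

text \<open>Height over base length of the caps of level \<open>n\<close>. The sign alternates
  because all bases are directed from start to end of the curve and a child lies on the other side
  of its base than its parent does of its own.\<close>

definition slope :: "real \<Rightarrow> nat \<Rightarrow> real" where
  "slope \<epsilon> n = (-1) ^ n * (2 * \<epsilon> / sqrt (1 + 16 * real n * \<epsilon>\<^sup>2))"

definition len :: "real \<Rightarrow> nat \<Rightarrow> real" where
  "len \<epsilon> n = sqrt (1 + 16 * real n * \<epsilon>\<^sup>2) / 2 ^ n"

definition children :: "plane \<Rightarrow> plane \<Rightarrow> real \<Rightarrow> bool \<Rightarrow> plane \<times> plane" where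
  "children a d t left =
     (if left then (a, (1/2) *\<^sub>R d + t *\<^sub>R rot d)
      else (a + (1/2) *\<^sub>R d + t *\<^sub>R rot d, (1/2) *\<^sub>R d - t *\<^sub>R rot d))"

text \<open>Start point and direction vector of the base of a cap; unlike in \<^const>\<open>cap_vertices\<close>, the index
  \<open>i\<close> runs from \<open>0\<close>.\<close>

primrec base :: "real \<Rightarrow> nat \<Rightarrow> nat \<Rightarrow> plane \<times> plane" where
  "base \<epsilon> 0 i = ((0, 0), (1, 0))"
| "base \<epsilon> (Suc n) i =
     children (fst (base \<epsilon> n (i div 2))) (snd (base \<epsilon> n (i div 2))) (slope \<epsilon> n) (even i)"

definition cap :: "real \<Rightarrow> nat \<Rightarrow> nat \<Rightarrow> plane set" where
  "cap \<epsilon> n i = tri (fst (base \<epsilon> n i)) (snd (base \<epsilon> n i)) (slope \<epsilon> n)"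

locale curve =
  fixes \<epsilon> :: real
  assumes eps: "0 < \<epsilon>" "\<epsilon> < 1/100"
begin

lemma len_pos: "len \<epsilon> n > 0"
  using eps by (simp add: len_def add_pos_nonneg)

lemma len_sq: "(len \<epsilon> n)\<^sup>2 = (1 + 16 * real n * \<epsilon>\<^sup>2) / 4 ^ n"
proof -
  have "(2 ^ n)\<^sup>2 = (4 ^ n :: real)" by (simp flip: power_mult_distrib add: power2_eq_square)
  then show ?thesis by (simp add: len_def power_divide add_nonneg_nonneg)
qed

lemma abs_slope: "\<bar>slope \<epsilon> n\<bar> = 2 * \<epsilon> / sqrt (1 + 16 * real n * \<epsilon>\<^sup>2)"
  using eps by (simp add: slope_def abs_mult power_abs)

lemma slope_sq: "(slope \<epsilon> n)\<^sup>2 = 4 * \<epsilon>\<^sup>2 / (1 + 16 * real n * \<epsilon>\<^sup>2)"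
proof -
  have "(slope \<epsilon> n)\<^sup>2 = \<bar>slope \<epsilon> n\<bar>\<^sup>2" by simp
  then show ?thesis unfolding abs_slope by (simp add: power_divide add_nonneg_nonneg)
qed

lemma cap_height_eq: "cap_height \<epsilon> n = \<bar>slope \<epsilon> n\<bar> * len \<epsilon> n"
proof -
  have "(1::real) + 16 * real n * \<epsilon>\<^sup>2 > 0" by (simp add: add_pos_nonneg)
  then show ?thesis
    by (simp add: abs_slope len_def cap_height_def power_int_diff power_int_of_nat)
qed

text \<open>Places every pair of consecutive levels under \<open>cap_ratio\<close>; \<open>k\<close>
  is the quotient of the two square roots, and \<open>\<epsilon> < 1/100\<close> gives the bound
  1/50.\<close>

lemma slope_Suc:
  obtains k where "slope \<epsilon> (Suc n) = - k * slope \<epsilon> n" "cap_ratio (slope \<epsilon> n) k"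
proof -
  let ?q = "\<lambda>n. sqrt (1 + 16 * real n * \<epsilon>\<^sup>2)"
  have q: "?q n \<ge> 1" for n by simp
  have q0: "0 < ?q n" for n by (simp add: add_pos_nonneg)
  have mono: "?q n \<le> ?q (Suc n)" using eps by (simp add: algebra_simps)
  have "cap_ratio (slope \<epsilon> n) (?q n / ?q (Suc n))"
  proof
    show "0 < \<bar>slope \<epsilon> n\<bar>"
      unfolding abs_slope using eps(1) by (simp add: add_pos_nonneg)
    have "2 * \<epsilon> / ?q n \<le> 2 * \<epsilon> / 1" using eps q[of n] by (intro divide_left_mono) (auto simp: add_pos_nonneg)
    then show "\<bar>slope \<epsilon> n\<bar> \<le> 1/50" unfolding abs_slope using eps by linarith
    show "0 < ?q n / ?q (Suc n)" by (intro divide_pos_pos q0)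
    show "?q n / ?q (Suc n) \<le> 1" using mono by (simp only: divide_le_eq_1_pos[OF q0])
  qed
  moreover have "slope \<epsilon> (Suc n) = - (?q n / ?q (Suc n)) * slope \<epsilon> n"
    using q0[of n] by (auto simp: slope_def simp del: of_nat_Suc)
  ultimately show ?thesis using that by blast
qed

text \<open>Pythagoras with half the base and the height: each level adds exactly
  \<open>16 * \<epsilon>\<^sup>2\<close> under the root in \<open>len\<close>.\<close>

lemma norm_child: "norm ((1/2) *\<^sub>R d + slope \<epsilon> n *\<^sub>R rot d) = len \<epsilon> (Suc n)"
    "norm ((1/2) *\<^sub>R d - slope \<epsilon> n *\<^sub>R rot d) = len \<epsilon> (Suc n)" if "norm d = len \<epsilon> n"
proof -
  have p: "(1::real) + 16 * real n * \<epsilon>\<^sup>2 > 0" by (simp add: add_pos_nonneg)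
  have "((1/2)\<^sup>2 + (slope \<epsilon> n)\<^sup>2) * (len \<epsilon> n)\<^sup>2 = (len \<epsilon> (Suc n))\<^sup>2"
  proof -
    define q where "q = (1::real) + 16 * real n * \<epsilon>\<^sup>2"
    have "((1/2)\<^sup>2 + 4 * \<epsilon>\<^sup>2 / q) * (q / 4 ^ n) = (q + 16 * \<epsilon>\<^sup>2) / 4 ^ Suc n"
      using p unfolding q_def[symmetric] by (simp add: field_simps power2_eq_square)
    moreover have "1 + 16 * real (Suc n) * \<epsilon>\<^sup>2 = q + 16 * \<epsilon>\<^sup>2"
      by (simp add: q_def algebra_simps)
    ultimately show ?thesis by (simp only: slope_sq len_sq q_def[symmetric])
  qed
  then have "sqrt ((1/2)\<^sup>2 + (slope \<epsilon> n)\<^sup>2) * len \<epsilon> n = len \<epsilon> (Suc n)"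
    using len_pos[of n] len_pos[of "Suc n"] by (metis abs_of_pos real_sqrt_abs real_sqrt_mult)
  then show "norm ((1/2) *\<^sub>R d + slope \<epsilon> n *\<^sub>R rot d) = len \<epsilon> (Suc n)"
    "norm ((1/2) *\<^sub>R d - slope \<epsilon> n *\<^sub>R rot d) = len \<epsilon> (Suc n)"
    using norm_rot_frame[of "1/2" d "slope \<epsilon> n"] norm_rot_frame[of "1/2" d "- slope \<epsilon> n"] that
    by simp_all
qed

lemma norm_base: "norm (snd (base \<epsilon> n i)) = len \<epsilon> n"
proof (induction n arbitrary: i)
  case 0
  then show ?case by (simp add: len_def)
next
  case (Suc n)
  then show ?case by (simp add: children_def norm_child)
qed

lemma base_nonzero: "snd (base \<epsilon> n i) \<noteq> 0"
  using norm_base[of n i] len_pos[of n] by auto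

lemma cap_Suc_subset: "cap \<epsilon> (Suc n) i \<subseteq> cap \<epsilon> n (i div 2)"
  by (rule slope_Suc[of n])
    (auto simp: cap_def children_def dest: cap_ratio.left_child_subset[THEN subsetD]
      cap_ratio.right_child_subset[THEN subsetD])

lemma cap_apexes_base:
  "cap_apexes (cap_height \<epsilon> n) (fst (base \<epsilon> n i)) (fst (base \<epsilon> n i) + snd (base \<epsilon> n i)) =
    {fst (base \<epsilon> n i) + (1/2) *\<^sub>R snd (base \<epsilon> n i) + slope \<epsilon> n *\<^sub>R rot (snd (base \<epsilon> n i)),
     fst (base \<epsilon> n i) + (1/2) *\<^sub>R snd (base \<epsilon> n i) - slope \<epsilon> n *\<^sub>R rot (snd (base \<epsilon> n i))}"
proof -
  have "cap_height \<epsilon> n = \<bar>slope \<epsilon> n\<bar> * norm (snd (base \<epsilon> n i))"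
    unfolding norm_base by (rule cap_height_eq)
  from cap_apexes_eq[OF base_nonzero this abs_ge_zero] show ?thesis by (auto simp: abs_if)
qed

lemma wrong_apex:
  "fst (base \<epsilon> (Suc n) i) + (1/2) *\<^sub>R snd (base \<epsilon> (Suc n) i)
     - slope \<epsilon> (Suc n) *\<^sub>R rot (snd (base \<epsilon> (Suc n) i)) \<notin> cap \<epsilon> n (i div 2)"
proof (rule slope_Suc[of n])
  fix k assume k: "slope \<epsilon> (Suc n) = - k * slope \<epsilon> n" "cap_ratio (slope \<epsilon> n) k"
  show ?thesis
    using cap_ratio.left_apex_outside[OF k(2) base_nonzero[of n "i div 2"], of "fst (base \<epsilon> n (i div 2))"]
      cap_ratio.right_apex_outside[OF k(2) base_nonzero[of n "i div 2"], of "fst (base \<epsilon> n (i div 2))"]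
    by (simp add: k(1) cap_def children_def)
qed

text \<open>Links the explicit tree to the \<open>THE\<close>-based definition. The shift to
  \<open>Suc i\<close> swaps parities, so the odd (first) edges there are the even indices here. Of
  the two possible apexes, \<open>cap_Suc_subset\<close> admits one and \<open>wrong_apex\<close>
  excludes the other.\<close>

lemma cap_vertices_eq:
  "cap_vertices \<epsilon> n (Suc i) = (fst (base \<epsilon> n i), fst (base \<epsilon> n i) + snd (base \<epsilon> n i),
     fst (base \<epsilon> n i) + (1/2) *\<^sub>R snd (base \<epsilon> n i) + slope \<epsilon> n *\<^sub>R rot (snd (base \<epsilon> n i)))"
proof (induction n arbitrary: i)
  case 0
  have "(THE p. p \<in> cap_apexes (cap_height \<epsilon> 0) (0, 0) (1, 0) \<and> snd p > 0) = (1/2, 2 * \<epsilon>)"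
    using eps cap_apexes_base[of 0 0] by (intro the_equality) (auto simp: rot_def slope_def)
  then show ?case by (simp add: rot_def slope_def)
next
  case (Suc n)
  let ?a = "fst (base \<epsilon> n (i div 2))" and ?d = "snd (base \<epsilon> n (i div 2))"
  let ?p = "?a + (1/2) *\<^sub>R ?d + slope \<epsilon> n *\<^sub>R rot ?d"
  let ?u = "fst (base \<epsilon> (Suc n) i)" and ?w = "snd (base \<epsilon> (Suc n) i)"
  let ?q = "?u + (1/2) *\<^sub>R ?w + slope \<epsilon> (Suc n) *\<^sub>R rot ?w"
  have parent: "cap_vertices \<epsilon> n ((Suc i + 1) div 2) = (?a, ?a + ?d, ?p)"
    using Suc.IH[of "i div 2"] by simp
  have uv: "(if odd (Suc i) then (?a, ?p) else (?p, ?a + ?d)) = (?u, ?u + ?w)"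
    by (simp add: children_def algebra_simps) (simp flip: scaleR_add_left)
  have hull: "convex hull {?a, ?a + ?d, ?p} = cap \<epsilon> n (i div 2)"
    by (simp add: cap_def convex_hull_cap)
  have hull': "convex hull {?u, ?u + ?w, ?q} = cap \<epsilon> (Suc n) i"
    by (simp only: cap_def convex_hull_cap)
  have the_q: "(THE q. q \<in> cap_apexes (cap_height \<epsilon> (Suc n)) ?u (?u + ?w) \<and>
             convex hull {?u, ?u + ?w, q} \<subseteq> convex hull {?a, ?a + ?d, ?p}) = ?q"
  proof (rule the_equality, intro conjI)
    show "?q \<in> cap_apexes (cap_height \<epsilon> (Suc n)) ?u (?u + ?w)"
      unfolding cap_apexes_base by blast
    show "convex hull {?u, ?u + ?w, ?q} \<subseteq> convex hull {?a, ?a + ?d, ?p}"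
      unfolding hull hull' by (rule cap_Suc_subset)
  next
    fix q assume q: "q \<in> cap_apexes (cap_height \<epsilon> (Suc n)) ?u (?u + ?w) \<and>
             convex hull {?u, ?u + ?w, q} \<subseteq> convex hull {?a, ?a + ?d, ?p}"
    \<comment> \<open>Containment of the hulls is used only for the vertex \<open>q\<close>
      itself.\<close>
    then have "q \<in> cap \<epsilon> n (i div 2)" unfolding hull by (blast intro: hull_inc)
    then show "q = ?q" using q wrong_apex[of n i] unfolding cap_apexes_base by blast
  qed
  show ?case
    unfolding cap_vertices.simps parent Let_def split_conv uv the_q ..
qed


text \<open>In squares: the denominator quadruples, while the numerator grows only by
  \<open>16 * \<epsilon>\<^sup>2\<close>, which is below 3.\<close>

lemma len_Suc_le: "len \<epsilon> (Suc n) \<le> len \<epsilon> n"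
proof -
  have "(len \<epsilon> (Suc n))\<^sup>2 \<le> (len \<epsilon> n)\<^sup>2"
  proof -
    have "\<epsilon>\<^sup>2 \<le> (1/100)\<^sup>2" using eps by (intro power_mono) auto
    then have "1 + 16 * real (Suc n) * \<epsilon>\<^sup>2 \<le> 4 * (1 + 16 * real n * \<epsilon>\<^sup>2)"
      using mult_nonneg_nonneg[of "real n" "\<epsilon>\<^sup>2"] by (simp add: algebra_simps power2_eq_square)
    then have "(1 + 16 * real (Suc n) * \<epsilon>\<^sup>2) / 4 ^ Suc n \<le> 4 * (1 + 16 * real n * \<epsilon>\<^sup>2) / 4 ^ Suc n"
      by (intro divide_right_mono) auto
    also have "\<dots> = (1 + 16 * real n * \<epsilon>\<^sup>2) / 4 ^ n"
      by (simp only: power_Suc mult_divide_mult_cancel_left[OF zero_neq_numeral[symmetric]])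
    finally show ?thesis unfolding len_sq .
  qed
  then show ?thesis using len_pos[of n] by (rule power2_le_imp_le[OF _ less_imp_le])
qed

lemma cap_subset_cball: "cap \<epsilon> n i \<subseteq> cball (fst (base \<epsilon> n i)) (2 * len \<epsilon> n)"
proof
  fix P assume "P \<in> cap \<epsilon> n i"
  then obtain x z where *: "0 \<le> z" "z \<le> 2 * x" "z \<le> 2 * (1 - x)"
    "P = fst (base \<epsilon> n i) + x *\<^sub>R snd (base \<epsilon> n i) + (z * slope \<epsilon> n) *\<^sub>R rot (snd (base \<epsilon> n i))"
    unfolding cap_def tri_def by blast
  have "\<bar>slope \<epsilon> n\<bar> \<le> 1"
    by (rule slope_Suc[of n]) (auto simp: cap_ratio_def)
  then have "\<bar>z * slope \<epsilon> n\<bar> \<le> 1 * 1"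
    unfolding abs_mult using * by (intro mult_mono) auto
  then have "sqrt (x\<^sup>2 + (z * slope \<epsilon> n)\<^sup>2) \<le> 2"
    using sqrt_sum_squares_le_sum_abs[of x "z * slope \<epsilon> n"] * by argo
  then have "dist P (fst (base \<epsilon> n i)) \<le> 2 * len \<epsilon> n"
    using len_pos[of n] norm_rot_frame[of x "snd (base \<epsilon> n i)" "z * slope \<epsilon> n"]
    by (simp add: *(4) dist_norm norm_base mult_right_mono algebra_simps)
  then show "P \<in> cball (fst (base \<epsilon> n i)) (2 * len \<epsilon> n)" by (simp add: dist_commute)
qed

section \<open>Separation of caps of the same level\<close>

lemma left_child_far_end:
  assumes "P \<in> cap \<epsilon> (Suc n) i" "even i"
  shows "len \<epsilon> n / 2 \<le> dist P (fst (base \<epsilon> n (i div 2)) + snd (base \<epsilon> n (i div 2)))"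
proof (rule slope_Suc[of n])
  fix k assume k: "slope \<epsilon> (Suc n) = - k * slope \<epsilon> n" "cap_ratio (slope \<epsilon> n) k"
  have "P \<in> tri (fst (base \<epsilon> n (i div 2)))
      ((1/2) *\<^sub>R snd (base \<epsilon> n (i div 2)) + slope \<epsilon> n *\<^sub>R rot (snd (base \<epsilon> n (i div 2)))) (- k * slope \<epsilon> n)"
    using assms by (simp add: cap_def children_def k(1))
  from cap_ratio.left_child_far[OF k(2) this] show ?thesis by (simp only: norm_base)
qed

lemma right_child_far_end:
  assumes "P \<in> cap \<epsilon> (Suc n) i" "odd i"
  shows "len \<epsilon> n / 2 \<le> dist P (fst (base \<epsilon> n (i div 2)))"
proof (rule slope_Suc[of n])
  fix k assume k: "slope \<epsilon> (Suc n) = - k * slope \<epsilon> n" "cap_ratio (slope \<epsilon> n) k"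
  let ?a = "fst (base \<epsilon> n (i div 2))" and ?d = "snd (base \<epsilon> n (i div 2))"
  have "P \<in> tri (?a + (1/2) *\<^sub>R ?d + slope \<epsilon> n *\<^sub>R rot ?d)
      ((1/2) *\<^sub>R ?d - slope \<epsilon> n *\<^sub>R rot ?d) (- k * slope \<epsilon> n)"
    using assms by (simp add: cap_def children_def k(1))
  from cap_ratio.right_child_far[OF k(2) this] show ?thesis by (simp only: norm_base)
qed

text \<open>For even \<open>i\<close> the caps are siblings meeting at the parent's apex. For odd
  \<open>i\<close> they lie in adjacent parents that meet at the same point, so the angle bound is
  inherited through nesting.\<close>

lemma adjacent_caps:
  assumes "Suc i < 2 ^ n"
  shows "fst (base \<epsilon> n (Suc i)) = fst (base \<epsilon> n i) + snd (base \<epsilon> n i)"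
    and "\<lbrakk>P \<in> cap \<epsilon> n i; Q \<in> cap \<epsilon> n (Suc i)\<rbrakk> \<Longrightarrow>
      inner (P - fst (base \<epsilon> n (Suc i))) (Q - fst (base \<epsilon> n (Suc i))) \<le> 0"
proof -
  have "fst (base \<epsilon> n (Suc i)) = fst (base \<epsilon> n i) + snd (base \<epsilon> n i) \<and>
    (\<forall>P\<in>cap \<epsilon> n i. \<forall>Q\<in>cap \<epsilon> n (Suc i).
      inner (P - fst (base \<epsilon> n (Suc i))) (Q - fst (base \<epsilon> n (Suc i))) \<le> 0)"
    using assms
  proof (induction n arbitrary: i)
    case 0
    then show ?case by simp
  next
    case (Suc n)
    show ?case
    proof (cases "even i")
      case True
      then have d: "Suc i div 2 = i div 2" by simp
      obtain k where k: "slope \<epsilon> (Suc n) = - k * slope \<epsilon> n" "cap_ratio (slope \<epsilon> n) k"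
        by (rule slope_Suc)
      show ?thesis
        using True cap_ratio.siblings_obtuse[OF k(2)] k(1)
        by (simp add: d cap_def children_def algebra_simps)
    next
      case False
      then have d: "Suc i div 2 = Suc (i div 2)" by presburger
      have "Suc (i div 2) < 2 ^ n" using Suc.prems False by simp presburger
      note IH = Suc.IH[OF this]
      let ?a = "fst (base \<epsilon> n (i div 2))" and ?d = "snd (base \<epsilon> n (i div 2))"
      have start: "fst (base \<epsilon> (Suc n) (Suc i)) = fst (base \<epsilon> n (Suc (i div 2)))"
        using False by (simp add: d children_def)
      have "fst (base \<epsilon> (Suc n) i) + snd (base \<epsilon> (Suc n) i) = ?a + ?d"
        using False by (simp add: children_def algebra_simps) (simp flip: scaleR_add_left)
      moreover have "cap \<epsilon> (Suc n) i \<subseteq> cap \<epsilon> n (i div 2)" "cap \<epsilon> (Suc n) (Suc i) \<subseteq> cap \<epsilon> n (Suc (i div 2))"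
        using cap_Suc_subset[of n i] cap_Suc_subset[of n "Suc i"] by (simp_all only: d)
      ultimately show ?thesis
        unfolding start using IH by (metis (no_types, lifting) subsetD)
    qed
  qed
  then show "fst (base \<epsilon> n (Suc i)) = fst (base \<epsilon> n i) + snd (base \<epsilon> n i)"
    and "\<lbrakk>P \<in> cap \<epsilon> n i; Q \<in> cap \<epsilon> n (Suc i)\<rbrakk> \<Longrightarrow>
      inner (P - fst (base \<epsilon> n (Suc i))) (Q - fst (base \<epsilon> n (Suc i))) \<le> 0" by auto
qed


text \<open>The parents are distinct. If they are not adjacent, induction applies; if they are, the
  angle at their common endpoint is at least 90 degrees, and one of the two children is the one away
  from that endpoint.\<close>

lemma nonadjacent_caps_dist:
  assumes "P \<in> cap \<epsilon> n i" "Q \<in> cap \<epsilon> n j" "i + 2 \<le> j" "j < 2 ^ n"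
  shows "len \<epsilon> n / 2 \<le> dist P Q"
  using assms
proof (induction n arbitrary: i j)
  case 0
  then show ?case by simp
next
  case (Suc n)
  let ?I = "i div 2" and ?J = "j div 2"
  have P: "P \<in> cap \<epsilon> n ?I" and Q: "Q \<in> cap \<epsilon> n ?J"
    using Suc.prems cap_Suc_subset by blast+
  have J: "?J < 2 ^ n" using Suc.prems by simp
  have "len \<epsilon> n / 2 \<le> dist P Q"
  proof (cases "?I + 2 \<le> ?J")
    case True
    then show ?thesis using Suc.IH P Q J by blast
  next
    case False
    then have eq: "?J = Suc ?I" using Suc.prems by presburger
    have "inner (P - fst (base \<epsilon> n ?J)) (Q - fst (base \<epsilon> n ?J)) \<le> 0"
      using adjacent_caps(2)[of ?I n P Q] P Q J eq by simp
    note le = obtuse_dist_le[OF this]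
    \<comment> \<open>Otherwise both children would touch the common endpoint, and
      \<open>j = i + 1\<close>.\<close>
    have "even i \<or> odd j" using eq Suc.prems by presburger
    then show ?thesis
    proof
      assume "even i"
      moreover have "fst (base \<epsilon> n ?J) = fst (base \<epsilon> n ?I) + snd (base \<epsilon> n ?I)"
        using adjacent_caps(1)[of ?I n] J eq by simp
      ultimately show ?thesis using left_child_far_end[OF Suc.prems(1)] le by simp
    next
      assume "odd j"
      then show ?thesis using right_child_far_end[OF Suc.prems(2)] le by linarith
    qed
  qed
  then show ?case using len_Suc_le[of n] by linarith
qed

section \<open>The limit curve and its inverse modulus of continuity\<close>

definition dyadic_index :: "nat \<Rightarrow> real \<Rightarrow> nat" where
  "dyadic_index n t = nat \<lfloor>2 ^ n * t\<rfloor>"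

text \<open>A point of a decreasing sequence of compact caps; all later arguments rest on
  \<open>\<gamma>_in_cap\<close> alone.\<close>

definition \<gamma> :: "real \<Rightarrow> plane" where
  "\<gamma> t = (SOME P. \<forall>n. P \<in> cap \<epsilon> n (dyadic_index n t))"

definition params :: "plane set \<Rightarrow> real set" where
  "params C = {t \<in> {0..<1}. \<gamma> t \<in> C}"

lemma params_mono: "C \<subseteq> D \<Longrightarrow> params C \<subseteq> params D"
  by (auto simp: params_def)

lemma params_UN: "params (\<Union>i\<in>I. C i) = (\<Union>i\<in>I. params (C i))"
  by (auto simp: params_def)

lemma dyadic_index_Suc: "dyadic_index (Suc n) t div 2 = dyadic_index n t"
proof -
  have "\<lfloor>2 ^ n * t\<rfloor> = \<lfloor>(2 ^ Suc n * t) / real_of_int 2\<rfloor>" by simp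
  also have "\<dots> = \<lfloor>2 ^ Suc n * t\<rfloor> div 2" by (rule floor_divide_real_eq_div) simp
  finally show ?thesis by (simp add: dyadic_index_def nat_div_distrib)
qed

lemma dyadic_index_less: "dyadic_index n t < 2 ^ n" if "t \<in> {0..<1}"
proof -
  have "2 ^ n * t < 2 ^ n" using that by simp
  then have "\<lfloor>2 ^ n * t\<rfloor> < 2 ^ n" by (simp add: floor_less_iff)
  then show ?thesis by (simp add: dyadic_index_def nat_less_iff)
qed

lemma cap_compact_nonempty: "compact (cap \<epsilon> n i)" "cap \<epsilon> n i \<noteq> {}"
  unfolding cap_def convex_hull_cap[symmetric]
  by (auto intro!: finite_imp_compact_convex_hull)

lemma \<gamma>_in_cap: "\<gamma> t \<in> cap \<epsilon> n (dyadic_index n t)"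
proof -
  let ?K = "\<lambda>n. cap \<epsilon> n (dyadic_index n t)"
  have "decseq ?K"
    using cap_Suc_subset[of _ "dyadic_index (Suc _) t"] by (intro decseq_SucI) (simp add: dyadic_index_Suc)
  then have "\<Inter> (range ?K) \<noteq> {}"
    by (intro compact_nest) (auto simp: cap_compact_nonempty decseq_def)
  then have "\<exists>P. \<forall>n. P \<in> ?K n" by auto
  then show ?thesis unfolding \<gamma>_def by (rule someI2_ex) auto
qed

text \<open>Contrapositive of the separation: points that close lie in equal or adjacent caps, so
  the parameters lie in equal or adjacent dyadic intervals of length
  \<open>1 / 2 ^ n\<close>.\<close>

lemma \<gamma>_modulus:
  assumes "s \<in> {0..<1}" "t \<in> {0..<1}" "dist (\<gamma> s) (\<gamma> t) < len \<epsilon> n / 2"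
  shows "\<bar>s - t\<bar> \<le> 2 / 2 ^ n"
proof -
  have *: "t - s \<le> 2 / 2 ^ n"
    if "s \<in> {0..<1}" "t \<in> {0..<1}" "dist (\<gamma> s) (\<gamma> t) < len \<epsilon> n / 2" for s t
  proof -
    have "\<not> dyadic_index n s + 2 \<le> dyadic_index n t"
      using nonadjacent_caps_dist[OF \<gamma>_in_cap[of s n] \<gamma>_in_cap[of t n]] that dyadic_index_less[of t n]
      by linarith
    then have "real (dyadic_index n t) \<le> real (dyadic_index n s) + 1" by simp
    moreover have "real (dyadic_index n s) \<le> 2 ^ n * s"
      using that by (simp add: dyadic_index_def)
    moreover have "2 ^ n * t < real (dyadic_index n t) + 1"
      using that by (simp add: dyadic_index_def)
    ultimately have "2 ^ n * t \<le> 2 ^ n * s + 2" by linarith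
    then show ?thesis by (simp add: field_simps)
  qed
  show ?thesis using *[of s t] *[of t s] assms by (auto simp: dist_commute abs_if)
qed

lemma len_tendsto_0: "len \<epsilon> \<longlonglongrightarrow> 0"
proof -
  define c where "c = \<epsilon>\<^sup>2"
  have "c > 0" using eps by (simp add: c_def)
  then have "(\<lambda>n. sqrt (1 + 16 * real n * c) / 2 ^ n) \<longlonglongrightarrow> 0" by real_asymp
  then show ?thesis unfolding len_def c_def .
qed

lemma \<gamma>_in_closure:
  assumes "t \<in> {0..<1}"
  shows "\<gamma> t \<in> closure (\<Union>n\<in>{1..}. poly_curve \<epsilon> n)"
  unfolding closure_approachable
proof (intro allI impI)
  fix e :: real assume "e > 0"
  then have "\<forall>\<^sub>F n in sequentially. len \<epsilon> n < e / 2"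
    using len_tendsto_0 by (intro order_tendstoD) auto
  moreover have "\<forall>\<^sub>F n in sequentially. 1 \<le> n" by (rule eventually_ge_at_top)
  ultimately have "\<forall>\<^sub>F n in sequentially. len \<epsilon> n < e / 2 \<and> 1 \<le> n" by (rule eventually_conj)
  then obtain n where n: "len \<epsilon> n < e / 2" "1 \<le> n"
    using eventually_happens'[OF sequentially_bot] by blast
  \<comment> \<open>The start of the base of the cap around \<open>\<gamma> t\<close> lies on the
    polygonal curve of level \<open>n\<close>, within \<open>2 * len \<epsilon> n\<close> of
    \<open>\<gamma> t\<close>.\<close>
  let ?a = "fst (base \<epsilon> n (dyadic_index n t))"
  have "?a \<in> poly_segment \<epsilon> n (Suc (dyadic_index n t))"
    by (simp add: poly_segment_def cap_vertices_eq)
  then have "?a \<in> poly_curve \<epsilon> n"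
    unfolding poly_curve_def using dyadic_index_less[OF assms, of n] by force
  moreover have "dist ?a (\<gamma> t) < e"
    using cap_subset_cball[of n "dyadic_index n t"] \<gamma>_in_cap[of t n] n by force
  ultimately show "\<exists>y\<in>\<Union>n\<in>{1..}. poly_curve \<epsilon> n. dist y (\<gamma> t) < e" using n by auto
qed

section \<open>Measure of preimages under the limit curve\<close>

lemma preimage_small:
  assumes "\<And>x y. x \<in> C \<Longrightarrow> y \<in> C \<Longrightarrow> dist x y < len \<epsilon> n / 2"
  shows "\<exists>c. params C \<subseteq> {c - 2 / 2 ^ n..c + 2 / 2 ^ n}"
proof (cases "\<exists>s\<in>{0..<1}. \<gamma> s \<in> C")
  case True
  then obtain s where s: "s \<in> {0..<1}" "\<gamma> s \<in> C" by blast
  have "t \<in> {s - 2 / 2 ^ n..s + 2 / 2 ^ n}" if "t \<in> {0..<1}" "\<gamma> t \<in> C" for t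
    using \<gamma>_modulus[OF s(1) that(1) assms[OF s(2) that(2)]] by (simp add: abs_le_iff)
  then show ?thesis unfolding params_def by blast
qed (auto simp: params_def)

text \<open>The factor \<open>\<eta>\<close> can be arbitrarily small because \<open>2 ^ n * len \<epsilon> n\<close> tends to infinity.\<close>

lemma preimage_density:
  assumes "0 < \<eta>"
  obtains \<delta> where "0 < \<delta>" "\<And>d C. \<lbrakk>0 < d; d \<le> \<delta>; \<And>x y. x \<in> C \<Longrightarrow> y \<in> C \<Longrightarrow> dist x y \<le> d\<rbrakk> \<Longrightarrow>
    \<exists>c. params C \<subseteq> {c - \<eta> * d..c + \<eta> * d}"
proof -
  \<comment> \<open>From level \<open>N\<close> on, \<open>2 ^ n * len \<epsilon> n\<close> is at
    least \<open>8 / \<eta>\<close>.\<close>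
  obtain N :: nat where N: "64 / \<eta>\<^sup>2 / (16 * \<epsilon>\<^sup>2) < real N" using reals_Archimedean2 by blast
  have root: "8 / \<eta> \<le> sqrt (1 + 16 * real n * \<epsilon>\<^sup>2)" if "n \<ge> N" for n
  proof (rule real_le_rsqrt)
    have "64 / \<eta>\<^sup>2 / (16 * \<epsilon>\<^sup>2) < real n" using N that by linarith
    then have "64 / \<eta>\<^sup>2 < real n * (16 * \<epsilon>\<^sup>2)" using eps by (subst (asm) pos_divide_less_eq) auto
    then show "(8 / \<eta>)\<^sup>2 \<le> 1 + 16 * real n * \<epsilon>\<^sup>2" by (simp add: power_divide)
  qed
  show ?thesis
  proof (rule that[of "len \<epsilon> N / 4"])
    show "0 < len \<epsilon> N / 4" using len_pos by simp
  next
    fix d and C :: "plane set" assume d: "0 < d" "d \<le> len \<epsilon> N / 4"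
      and C: "\<And>x y. x \<in> C \<Longrightarrow> y \<in> C \<Longrightarrow> dist x y \<le> d"
    have "\<forall>\<^sub>F n in sequentially. len \<epsilon> n < 2 * d"
      using len_tendsto_0 d by (intro order_tendstoD) auto
    then obtain n0 where n0: "len \<epsilon> n0 < 2 * d"
      using eventually_happens'[OF sequentially_bot] by blast
    \<comment> \<open>The scale of \<open>d\<close>: level \<open>m - 1\<close> still has length
      above \<open>2 * d\<close>, so \<open>preimage_small\<close> applies there, while
      \<open>len \<epsilon> m \<le> 2 * d\<close> bounds the resulting width by a multiple of
      \<open>d\<close>. The choice of \<open>len \<epsilon> N / 4\<close> forces
      \<open>m > N\<close>.\<close>
    define m where "m = (LEAST n. len \<epsilon> n \<le> 2 * d)"
    have m: "len \<epsilon> m \<le> 2 * d"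
      unfolding m_def using less_imp_le[OF n0] by (rule LeastI)
    have below: "2 * d < len \<epsilon> n" if "n < m" for n
      using not_less_Least[OF that[unfolded m_def]] by simp
    have anti: "decseq (len \<epsilon>)" using len_Suc_le by (rule decseq_SucI)
    have "N < m"
    proof (rule ccontr)
      assume "\<not> N < m"
      then have "len \<epsilon> N \<le> len \<epsilon> m" using anti by (simp add: decseq_def)
      then show False using m d len_pos[of N] by linarith
    qed
    then obtain n where n: "m = Suc n" "N \<le> n" by (cases m) auto
    obtain c where c: "params C \<subseteq> {c - 2 / 2 ^ n..c + 2 / 2 ^ n}"
    proof (rule exE[OF preimage_small[of C n]])
      show "dist x y < len \<epsilon> n / 2" if "x \<in> C" "y \<in> C" for x y
        using C[OF that] below[of n] n by simp
    qed blast
    have "8 / \<eta> / 2 ^ Suc n \<le> len \<epsilon> (Suc n)"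
      unfolding len_def using root[of "Suc n"] n by (intro divide_right_mono) auto
    also have "\<dots> \<le> 2 * d" using m n by simp
    finally have "2 / 2 ^ n \<le> \<eta> * d" using assms by (simp add: field_simps)
    then have "{c - 2 / 2 ^ n..c + 2 / 2 ^ n} \<subseteq> {c - \<eta> * d..c + \<eta> * d}" by auto
    with c show "\<exists>c. params C \<subseteq> {c - \<eta> * d..c + \<eta> * d}" by blast
  qed
qed

section \<open>Null preimages\<close>

lemma negligible_preimage_hausdorff1:
  assumes "hausdorff1 M = 0"
  shows "negligible (params M)"
proof (rule negligible_interval_cover)
  fix e :: real assume "0 < e"
  obtain \<delta> where \<delta>: "0 < \<delta>" "\<And>d C. \<lbrakk>0 < d; d \<le> \<delta>; \<And>x y. x \<in> C \<Longrightarrow> y \<in> C \<Longrightarrow> dist x y \<le> d\<rbrakk> \<Longrightarrow>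
    \<exists>c. params C \<subseteq> {c - 1 * d..c + 1 * d}"
    \<comment> \<open>A bounded density suffices here, so the factor is 1.\<close>
    by (rule preimage_density[of 1]) auto
  define \<tau> where "\<tau> = min (e / 2) (\<delta> / 2)"
  have \<tau>: "0 < \<tau>" "\<tau> \<le> e / 2" "\<tau> \<le> \<delta> / 2" using \<open>0 < e\<close> \<delta> by (auto simp: \<tau>_def)
  obtain C where C: "M \<subseteq> (\<Union>j::nat. C j)" "\<And>j. bounded (C j)" "\<And>j. diameter (C j) \<le> \<delta> / 2"
    "(\<Sum>j. ennreal (diameter (C j))) < ennreal \<tau>"
    using hausdorff1_null_cover[OF assms, of "\<delta>/2" \<tau>] \<tau> \<delta> by auto
  \<comment> \<open>Covering sets may have diameter 0, but \<open>preimage_density\<close> asks for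
    a positive bound. The padding sums to \<open>\<tau>\<close>, so all half-widths together stay
    below \<open>2 * \<tau> \<le> e\<close>.\<close>
  define d where "d j = diameter (C j) + \<tau> * (1/2) ^ Suc j" for j
  have "(1/2) ^ Suc j \<le> (1::real)" for j by (rule power_le_one) auto
  then have tail: "\<tau> * (1/2) ^ Suc j \<le> \<tau>" for j
    using \<tau> by (intro mult_left_le) auto
  have tail0: "0 < \<tau> * (1/2) ^ Suc j" for j using \<tau> by simp
  have d: "0 < d j" "d j \<le> \<delta>" for j
    unfolding d_def using diameter_ge_0[OF C(2)[of j]] tail[of j] tail0[of j] C(3)[of j] \<tau>
    by linarith+
  have d_dist: "dist x y \<le> d j" if "x \<in> C j" "y \<in> C j" for x y j
    unfolding d_def using diameter_bounded_bound[OF C(2)[of j] that] tail0[of j] by linarith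
  have "\<exists>c. params (C j) \<subseteq> {c - d j..c + d j}" for j
    using \<delta>(2)[OF d(1) d(2) d_dist] by simp
  then obtain c where c: "\<And>j. params (C j) \<subseteq> {c j - d j..c j + d j}" by metis
  have "(\<Sum>j. ennreal (d j)) = (\<Sum>j. ennreal (diameter (C j)) + ennreal (\<tau> * (1/2) ^ Suc j))"
    unfolding d_def using diameter_ge_0[OF C(2)] less_imp_le[OF tail0]
    by (simp only: ennreal_plus)
  also have "\<dots> = (\<Sum>j. ennreal (diameter (C j))) + (\<Sum>j. ennreal (\<tau> * (1/2) ^ Suc j))"
    by (rule suminf_add[symmetric]) auto
  also have "(\<Sum>j. ennreal (\<tau> * (1/2) ^ Suc j)) = ennreal \<tau>"
    using sums_mult[OF power_half_series, of \<tau>] less_imp_le[OF tail0]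
    by (subst suminf_ennreal2) (auto simp: sums_iff)
  also have "(\<Sum>j. ennreal (diameter (C j))) + ennreal \<tau> \<le> ennreal \<tau> + ennreal \<tau>"
    using C(4) by (intro add_right_mono) simp
  also have "\<dots> \<le> ennreal e" using \<tau> by (simp flip: ennreal_plus)
  finally have "(\<Sum>j. ennreal (d j)) \<le> ennreal e" .
  moreover have "params M \<subseteq> (\<Union>j. {c j - d j..c j + d j})"
  proof -
    have "params M \<subseteq> (\<Union>j. params (C j))" using params_mono[OF C(1)] by (simp only: params_UN)
    also have "\<dots> \<subseteq> (\<Union>j. {c j - d j..c j + d j})" by (intro UN_mono c) simp
    finally show ?thesis .
  qed
  ultimately show "\<exists>c r. (\<forall>j. 0 \<le> r j) \<and> params M \<subseteq> (\<Union>j::nat. {c j - r j..c j + r j}) \<and>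
      (\<Sum>j. ennreal (r j)) \<le> ennreal e"
    using less_imp_le[OF d(1)] by (intro exI[of _ c] exI[of _ d] conjI allI)
qed

text \<open>Cut the arc into pieces of diameter at most \<open>L' / m\<close>. Their total size
  stays bounded as \<open>m\<close> grows, so it is the arbitrarily small density factor that makes
  the preimage null.\<close>

lemma negligible_preimage_lipschitz_arc:
  fixes F :: "real \<Rightarrow> plane"
  assumes "L-lipschitz_on UNIV F"
  shows "negligible (params (F ` {k..k+1}))"
proof (rule negligible_interval_cover)
  fix e :: real assume "0 < e"
  define L' where "L' = max L 1"
  have L': "L' > 0" "dist (F x) (F y) \<le> L' * dist x y" for x y
  proof -
    have "dist (F x) (F y) \<le> L * dist x y" using assms by (auto simp: lipschitz_on_def)
    also have "\<dots> \<le> L' * dist x y" by (intro mult_right_mono) (auto simp: L'_def)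
    finally show "dist (F x) (F y) \<le> L' * dist x y" .
  qed (simp add: L'_def)
  obtain \<delta> where \<delta>: "0 < \<delta>" "\<And>d C. \<lbrakk>0 < d; d \<le> \<delta>; \<And>x y. x \<in> C \<Longrightarrow> y \<in> C \<Longrightarrow> dist x y \<le> d\<rbrakk> \<Longrightarrow>
    \<exists>c. params C \<subseteq> {c - e / (2 * L') * d..c + e / (2 * L') * d}"
  proof (rule preimage_density)
    show "0 < e / (2 * L')" using \<open>0 < e\<close> L' by simp
  qed blast
  obtain m :: nat where m: "L' / \<delta> < real m" using reals_Archimedean2 by blast
  have m0: "0 < real m" using L' \<delta> divide_pos_pos[of L' \<delta>] m by linarith
  define d where "d = L' / real m"
  have d: "0 < d" "d \<le> \<delta>" using L' \<delta> m m0 by (auto simp: d_def field_simps)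
  let ?I = "\<lambda>j::nat. {k + real j / real m..k + (real j + 1) / real m}"
  have "dist x y \<le> d" if xy: "x \<in> F ` ?I j" "y \<in> F ` ?I j" for x y j
  proof -
    obtain u v where uv: "x = F u" "y = F v" "u \<in> ?I j" "v \<in> ?I j" using xy by (elim imageE)
    then have "dist u v \<le> 1 / real m"
      by (auto simp: dist_real_def abs_le_iff add_divide_distrib)
    then have "L' * dist u v \<le> L' * (1 / real m)" using L' by (intro mult_left_mono) auto
    then show ?thesis using L'(2)[of u v] uv by (simp add: d_def)
  qed
  then have "\<exists>c. params (F ` ?I j) \<subseteq> {c - e / (2 * L') * d..c + e / (2 * L') * d}" for j
    using \<delta>(2)[OF d] by blast
  then obtain c where c: "\<And>j. params (F ` ?I j) \<subseteq> {c j - e / (2 * L') * d..c j + e / (2 * L') * d}"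
    by metis
  \<comment> \<open>The endpoint \<open>k + 1\<close> falls into piece \<open>m\<close>, so there
    are \<open>m + 1\<close> pieces.\<close>
  have cover: "\<exists>j\<le>m. u \<in> ?I j" if "u \<in> {k..k+1}" for u
  proof (intro exI conjI)
    let ?j = "nat \<lfloor>(u - k) * real m\<rfloor>"
    have u: "0 \<le> (u - k) * real m" "(u - k) * real m \<le> 1 * real m"
      using that m0 by (auto intro!: mult_right_mono)
    then have "\<lfloor>(u - k) * real m\<rfloor> \<le> \<lfloor>real m\<rfloor>" by (intro floor_mono) simp
    then show "?j \<le> m" by simp
    have "real ?j \<le> (u - k) * real m" "(u - k) * real m \<le> real ?j + 1" using u by auto
    then show "u \<in> ?I ?j" using m0 by (auto simp: field_simps)
  qed
  define r where "r j = (if j \<le> m then e / (2 * L') * d else 0)" for j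
  have r0: "0 \<le> e / (2 * L') * d" using L' d \<open>0 < e\<close> by auto
  have "(\<Sum>j. ennreal (r j)) = (\<Sum>j\<le>m. ennreal (r j))"
    by (rule suminf_finite) (auto simp: r_def)
  also have "\<dots> = (\<Sum>j\<le>m. ennreal (e / (2 * L') * d))" by (intro sum.cong) (auto simp: r_def)
  also have "\<dots> = ennreal (\<Sum>j\<le>m. e / (2 * L') * d)" using r0 by (intro sum_ennreal) auto
  also have "(\<Sum>j\<le>m. e / (2 * L') * d) \<le> e"
  proof -
    \<comment> \<open>The 2 in the density factor absorbs the extra piece, as
      \<open>m + 1 \<le> 2 * m\<close>.\<close>
    have "(\<Sum>j\<le>m. e / (2 * L') * d) = e * ((real m + 1) / (2 * real m))"
      using L' by (simp add: d_def field_simps)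
    also have "\<dots> \<le> e * 1"
      using m0 \<open>0 < e\<close> by (intro mult_left_mono) (auto simp: field_simps)
    finally show ?thesis by simp
  qed
  finally have "(\<Sum>j. ennreal (r j)) \<le> ennreal e" by (simp add: ennreal_leI)
  moreover have "params (F ` {k..k+1}) \<subseteq> (\<Union>j. {c j - r j..c j + r j})"
  proof -
    have "F ` {k..k+1} \<subseteq> (\<Union>j\<in>{..m}. F ` ?I j)" using cover by blast
    from params_mono[OF this] have "params (F ` {k..k+1}) \<subseteq> (\<Union>j\<in>{..m}. params (F ` ?I j))"
      by (simp only: params_UN)
    also have "\<dots> \<subseteq> (\<Union>j\<in>{..m}. {c j - r j..c j + r j})"
    proof (rule UN_mono[OF order_refl])
      show "params (F ` ?I j) \<subseteq> {c j - r j..c j + r j}" if "j \<in> {..m}" for j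
        using c[of j] that by (simp add: r_def)
    qed
    also have "\<dots> \<subseteq> (\<Union>j. {c j - r j..c j + r j})" by (rule UN_mono) auto
    finally show ?thesis .
  qed
  moreover have "\<forall>j. 0 \<le> r j" using r0 by (simp add: r_def)
  ultimately show "\<exists>c r. (\<forall>j. 0 \<le> r j) \<and>
      params (F ` {k..k+1}) \<subseteq> (\<Union>j::nat. {c j - r j..c j + r j}) \<and>
      (\<Sum>j. ennreal (r j)) \<le> ennreal e" by (intro exI[of _ c] exI[of _ r] conjI)
qed

lemma negligible_preimage_lipschitz:
  fixes F :: "real \<Rightarrow> plane"
  assumes "L-lipschitz_on UNIV F"
  shows "negligible (params (range F))"
proof -
  have "negligible (\<Union>k\<in>(UNIV::int set). params (F ` {of_int k..of_int k+1}))"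
    using negligible_preimage_lipschitz_arc[OF assms]
    by (intro negligible_countable_Union) auto
  moreover have "range F \<subseteq> (\<Union>k\<in>(UNIV::int set). F ` {of_int k..of_int k+1})"
  proof
    fix y assume "y \<in> range F"
    then obtain u where u: "y = F u" by blast
    have "u \<in> {of_int \<lfloor>u\<rfloor>..of_int \<lfloor>u\<rfloor>+1}" by simp
    then show "y \<in> (\<Union>k\<in>(UNIV::int set). F ` {of_int k..of_int k+1})" using u by blast
  qed
  ultimately show ?thesis by (metis negligible_subset params_mono params_UN)
qed

text \<open>\<open>A_limit\<close> omits these curves, so the parameters that hit them must be
  negligible. Each segment lies on the range of an affine, hence Lipschitz, map.\<close>

lemma negligible_preimage_poly_curve: "negligible (params (poly_curve \<epsilon> n))"
proof -
  have seg: "negligible (params (closed_segment a b))" for a b :: plane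
  proof (rule negligible_subset)
    show "negligible (params (range (\<lambda>u. a + u *\<^sub>R (b - a))))"
    proof (rule negligible_preimage_lipschitz)
      show "(norm (b - a))-lipschitz_on UNIV (\<lambda>u. a + u *\<^sub>R (b - a))"
        by (intro lipschitz_onI) (auto simp: dist_norm simp flip: scaleR_left_diff_distrib)
    qed
    have "closed_segment a b \<subseteq> range (\<lambda>u. a + u *\<^sub>R (b - a))"
      by (auto simp: closed_segment_def algebra_simps)
    then show "params (closed_segment a b) \<subseteq> params (range (\<lambda>u. a + u *\<^sub>R (b - a)))"
      by (rule params_mono)
  qed
  have "negligible (\<Union>i\<in>{1..2 ^ n}. params (poly_segment \<epsilon> n i))"
  proof (intro negligible_Union)
    show "negligible S" if S: "S \<in> (\<lambda>i. params (poly_segment \<epsilon> n i)) ` {1..2 ^ n}" for S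
    proof -
      obtain i where "S = params (poly_segment \<epsilon> n i)" using S by blast
      moreover obtain a b p where "cap_vertices \<epsilon> n i = (a, b, p)" by (metis prod_cases3)
      ultimately show ?thesis using seg[of a b] by (simp add: poly_segment_def)
    qed
  qed simp
  then show ?thesis by (simp add: poly_curve_def params_UN)
qed

section \<open>Removed balls and conclusion\<close>

text \<open>\<open>rho \<epsilon> 1\<close> is exactly \<open>len \<epsilon> 7 / 4\<close>, and each
  further factor 1/4 amounts to two levels, over which the root in \<open>len\<close> only grows.
  Hence ball \<open>Suc j\<close> is matched with level \<open>7 + 2 * j\<close>.\<close>

lemma radius_le: "2 * radius \<epsilon> (Suc j) \<le> len \<epsilon> (7 + 2 * j) / 2"
proof -
  have "radius \<epsilon> (Suc j) \<le> rho \<epsilon> (Suc j)" by (simp add: radius_def)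
  also have "\<dots> = sqrt (1 + 7 * 16 * \<epsilon>\<^sup>2) / (4 * 2 ^ 7 * 4 ^ j)"
    by (simp add: rho_def power_int_minus field_simps)
  also have "\<dots> \<le> sqrt (1 + 16 * real (7 + 2 * j) * \<epsilon>\<^sup>2) / (4 * 2 ^ 7 * 4 ^ j)"
    by (intro divide_right_mono real_sqrt_le_mono) (auto intro: mult_right_mono)
  also have "\<dots> = len \<epsilon> (7 + 2 * j) / 4"
    by (simp add: len_def power_add power_mult)
  finally show ?thesis by simp
qed

lemma preimage_balls:
  "\<exists>c. params (ball (vertex \<epsilon> (Suc j)) (radius \<epsilon> (Suc j)))
     \<subseteq> {c - 2 / 2 ^ (7 + 2 * j)..c + 2 / 2 ^ (7 + 2 * j)}"
proof (rule preimage_small)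
  fix x y assume "x \<in> ball (vertex \<epsilon> (Suc j)) (radius \<epsilon> (Suc j))"
    "y \<in> ball (vertex \<epsilon> (Suc j)) (radius \<epsilon> (Suc j))"
  then show "dist x y < len \<epsilon> (7 + 2 * j) / 2"
    using radius_le[of j] dist_triangle3[of x y "vertex \<epsilon> (Suc j)"] by auto
qed

lemma not_countably_1_rectifiable_A_final: "\<not> countably_1_rectifiable (A_final \<epsilon>)"
proof
  assume "countably_1_rectifiable (A_final \<epsilon>)"
  then obtain M0 and F :: "nat \<Rightarrow> real \<Rightarrow> plane" where
    rect: "hausdorff1 M0 = 0" "\<And>j. \<exists>L. L-lipschitz_on UNIV (F j)"
      "A_final \<epsilon> \<subseteq> M0 \<union> (\<Union>j. range (F j))"
    unfolding countably_1_rectifiable_def by blast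
  define N where "N = params M0 \<union> (\<Union>j. params (range (F j))) \<union> (\<Union>n. params (poly_curve \<epsilon> n))"
  have "negligible (params (range (F j)))" for j
    using rect(2)[of j] negligible_preimage_lipschitz by blast
  then have N: "negligible N"
    unfolding N_def using negligible_preimage_hausdorff1[OF rect(1)] negligible_preimage_poly_curve
    by (intro negligible_Un negligible_countable_Union) auto
  obtain c where c: "\<And>j. params (ball (vertex \<epsilon> (Suc j)) (radius \<epsilon> (Suc j)))
     \<subseteq> {c j - 2 / 2 ^ (7 + 2 * j)..c j + 2 / 2 ^ (7 + 2 * j)}"
    using preimage_balls by metis
  let ?B = "\<lambda>j::nat. {c j - 2 / 2 ^ (7 + 2 * j)..c j + 2 / 2 ^ (7 + 2 * j)}"
  have cover: "{0..<1} \<subseteq> N \<union> (\<Union>j. ?B j)"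
  proof
    fix t :: real assume t: "t \<in> {0..<1}"
    show "t \<in> N \<union> (\<Union>j. ?B j)"
    proof (cases "\<gamma> t \<in> A_final \<epsilon>")
      case True
      then have "\<gamma> t \<in> M0 \<or> (\<exists>j. \<gamma> t \<in> range (F j))" using rect(3) by blast
      then show ?thesis using t unfolding N_def params_def by auto
    next
      case False
      \<comment> \<open>\<open>\<gamma> t\<close> is in the closure of the polygonal curves, so it
        can miss \<open>A_final\<close> only by lying on one of them or in a removed ball.\<close>
      then consider n where "\<gamma> t \<in> poly_curve \<epsilon> n" |
        i where "i \<ge> 1" "\<gamma> t \<in> ball (vertex \<epsilon> i) (radius \<epsilon> i)"
        using \<gamma>_in_closure[OF t] unfolding A_final_def A_limit_def by blast
      then show ?thesis
      proof cases
        case (1 n)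
        then show ?thesis using t by (auto simp: N_def params_def)
      next
        case (2 i)
        define j where "j = i - 1"
        have "t \<in> params (ball (vertex \<epsilon> (Suc j)) (radius \<epsilon> (Suc j)))"
          using 2 t by (simp add: params_def j_def)
        with c[of j] have "t \<in> ?B j" by (rule subsetD)
        then show ?thesis by blast
      qed
    qed
  qed
  have N0: "N \<in> null_sets lebesgue" using N by (simp add: negligible_iff_null_sets)
  have "1 = emeasure lebesgue {0..<1::real}" by simp
  also have "\<dots> \<le> emeasure lebesgue (N \<union> (\<Union>j. ?B j))"
    using N0 by (intro emeasure_mono[OF cover]) auto
  also have "\<dots> = emeasure lebesgue (\<Union>j. ?B j)"
    using N0 by (subst Un_commute) (intro emeasure_Un_null_set, auto)
  also have "\<dots> \<le> (\<Sum>j. emeasure lebesgue (?B j))"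
    by (rule emeasure_subadditive_countably) auto
  \<comment> \<open>Interval \<open>j\<close> has length \<open>4 / 2 ^ (7 + 2 * j)\<close>; the
    geometric series sums to 1/24, short of the length 1 to be covered.\<close>
  also have "\<dots> = (\<Sum>j. ennreal (1/32 * (1/4) ^ j))"
  proof -
    have "(2::real) ^ (7 + 2 * j) = 128 * 4 ^ j" for j by (simp add: power_add power_mult)
    then show ?thesis by (simp add: field_simps power_one_over)
  qed
  also have "\<dots> = ennreal (1/32 * (1 / (1 - 1/4)))"
  proof -
    have "(\<lambda>j. 1/32 * (1/4) ^ j) sums (1/32 * (1 / (1 - 1/4 :: real)))"
      by (intro sums_mult geometric_sums) simp
    then show ?thesis by (subst suminf_ennreal2) (auto simp: sums_iff)
  qed
  also have "\<dots> < 1" by (simp add: ennreal_less_one_iff)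
  finally show False by simp
qed

end

theorem theorem8p6:
  fixes \<epsilon> :: real
  assumes "0 < \<epsilon>" and "\<epsilon> < 1/100"
  shows "\<not> countably_1_rectifiable (A_final \<epsilon>)"
  by (rule curve.not_countably_1_rectifiable_A_final) (use assms in \<open>simp add: curve_def\<close>)

end
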